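(* Let $n,m,t,a,r$ be positive integers with $m\ge 2$, $t\ge 3$, $2\le a\le \min\{m,t-1\}$ and $r=mt-a$. Define $$d:=\left\lceil\frac{(m-1)(r-1)n}{mt-2}\right\rceil,\qquad s:=\left\lfloor\frac{d}{m-1}\right\rfloor,\qquad T:=d-(m-1)s\in\{0,\dots,m-2\},$$ $$H:=n+td+(t-2)s-rn.$$ Then $$\delta(n,r,t)=(r-1)n-d-\varepsilon,$$ where $\varepsilon\in\{0,1\}$ is given by $$\varepsilon=\begin{cases}1,& H<0,\\ 1,& H=0\text{ and }(n-s)\nmid T,\\ 0,&\text{otherwise.}\end{cases}$$ Equivalently, $\min_A D(A)=d+\varepsilon$, where the minimum is over all $r\times t$ nonnegative integer matrices $A$ all of whose row sums equal $n$.
   Context: A balanced $r$-partite graph with parts of size $n$ is a simple graph whose vertex set is partitioned into $r$ independent sets $V_1,\dots,V_r$, each of size $n$. $\delta(G)$ denotes the minimum degree of $G$ and $\chi(G)$ its chromatic number. For positive integers $n,r,t$, $$\delta(n,r,t)=\max\{\delta(G): G\text{ is balanced }r\text{-partite with parts of size }n\text{ and }\chi(G)\le t\}.$$ For an $r\times t$ nonnegative integer matrix $A=(a_{ij})$ with all row sums equal to $n$, let $c_j=\sum_{i=1}^r a_{ij}$ be its $j$th column sum, and let $$D(A)=\max\{c_j-a_{ij}: 1\le i\le r,\ 1\le j\le t,\ a_{ij}>0\}.$$ *)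

theory Defs
  imports Complex_Main "HOL-Library.Disjoint_Sets"
begin

definition simple_graph :: "'a set \<Rightarrow> 'a set set \<Rightarrow> bool" where
  "simple_graph V E \<longleftrightarrow> finite V \<and> (\<forall>e\<in>E. e \<subseteq> V \<and> card e = 2)"

definition degree :: "'a set set \<Rightarrow> 'a \<Rightarrow> nat" where
  "degree E v = card {e \<in> E. v \<in> e}"

definition min_degree :: "'a set \<Rightarrow> 'a set set \<Rightarrow> nat" where
  "min_degree V E = Min (degree E ` V)"

definition proper_colouring :: "'a set \<Rightarrow> 'a set set \<Rightarrow> nat \<Rightarrow> ('a \<Rightarrow> nat) \<Rightarrow> bool" where
  "proper_colouring V E k f \<longleftrightarrow>
     f ` V \<subseteq> {..<k} \<and> (\<forall>u v. {u, v} \<in> E \<longrightarrow> f u \<noteq> f v)"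

definition chromatic_number :: "'a set \<Rightarrow> 'a set set \<Rightarrow> nat" where
  "chromatic_number V E = (LEAST k. \<exists>f. proper_colouring V E k f)"

definition independent_set :: "'a set set \<Rightarrow> 'a set \<Rightarrow> bool" where
  "independent_set E S \<longleftrightarrow> (\<forall>u\<in>S. \<forall>v\<in>S. {u, v} \<notin> E)"

definition balanced_partite :: "nat \<Rightarrow> nat \<Rightarrow> 'a set \<Rightarrow> 'a set set \<Rightarrow> bool" where
  "balanced_partite r n V E \<longleftrightarrow> simple_graph V E \<and>
     (\<exists>P :: nat \<Rightarrow> 'a set. (\<Union>i<r. P i) = V \<and> disjoint_family_on P {..<r} \<and>
        (\<forall>i<r. card (P i) = n \<and> independent_set E (P i)))"

text \<open>Every finite graph is isomorphic to one with vertices in \<^typ>\<open>nat\<close>, so restricting the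
  vertex type loses no value of the minimum degree. For positive arguments the set of values is
  finite (bounded by the number of vertices) and nonempty (take the edgeless graph).\<close>

definition delta_max :: "nat \<Rightarrow> nat \<Rightarrow> nat \<Rightarrow> nat" where
  "delta_max n r t =
     Max {min_degree V E | (V :: nat set) E. balanced_partite r n V E \<and> chromatic_number V E \<le> t}"

text \<open>An \<open>r \<times> t\<close> matrix is a function of which only the entries at \<open>i < r\<close>, \<open>j < t\<close> matter;
  rows and columns are numbered from \<open>0\<close>.\<close>

definition row_sums_eq :: "nat \<Rightarrow> nat \<Rightarrow> nat \<Rightarrow> (nat \<Rightarrow> nat \<Rightarrow> nat) \<Rightarrow> bool" where
  "row_sums_eq n r t A \<longleftrightarrow> (\<forall>i<r. (\<Sum>j<t. A i j) = n)"

definition col_sum :: "nat \<Rightarrow> (nat \<Rightarrow> nat \<Rightarrow> nat) \<Rightarrow> nat \<Rightarrow> nat" where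
  "col_sum r A j = (\<Sum>i<r. A i j)"

definition D_max :: "nat \<Rightarrow> nat \<Rightarrow> (nat \<Rightarrow> nat \<Rightarrow> nat) \<Rightarrow> nat" where
  "D_max r t A = Max {col_sum r A j - A i j | i j. i < r \<and> j < t \<and> A i j > 0}"

end

theory Submission imports Defs begin

text \<open>A graph with classes \<open>V\<^sub>i\<close> and colour classes \<open>W\<^sub>j\<close> has the matrix of cell sizes
  \<open>\<bar>V\<^sub>i \<inter> W\<^sub>j\<bar>\<close>; a vertex in cell \<open>(i, j)\<close> has degree at most \<open>(r - 1) * n - (c\<^sub>j - a\<^sub>i\<^sub>j)\<close>, with
  equality when all admissible edges are present. So it remains to minimise \<open>D\<close>.

  Suppose \<open>D A \<le> d\<close> and put \<open>x\<^sub>j = c\<^sub>j - d\<close>, so that every positive entry of column \<open>j\<close> is at least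
  \<open>x\<^sub>j\<close>. Averaging over the support of a column gives \<open>x\<^sub>j \<le> s\<close> for a support of size at least \<open>m\<close>,
  and the size of \<open>d\<close> gives it for smaller ones. Since \<open>r > (m - 1) * t\<close>, some row meets two
  columns \<open>p\<close>, \<open>q\<close>, whence \<open>x\<^sub>p + x\<^sub>q \<le> n\<close>. Summing up, \<open>r * n - t * d \<le> n + (t - 2) * s\<close>, that is
  \<open>H \<ge> 0\<close>. If \<open>H = 0\<close>, every third column has \<open>x\<^sub>j = s\<close> and all its positive entries are \<open>s\<close> or
  \<open>n\<close>, which forces exactly \<open>m\<close> positive entries and \<open>(n - s) dvd T\<close>.

  Conversely, let columns \<open>1, \<dots>, t - 1\<close> occupy disjoint blocks of \<open>m\<close> rows, with entries \<open>s\<close> and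
  \<open>s + 1\<close> if \<open>H > 0\<close> and \<open>s\<close> and \<open>n\<close> if \<open>H = 0\<close>, adding up to \<open>d + s\<close>, and let column \<open>0\<close> fill up the
  rows. Replacing \<open>d\<close> by \<open>d + 1\<close> always makes \<open>H\<close> positive.\<close>

section \<open>Row sums, column sums and \<open>D_max\<close>\<close>

text \<open>Meant for a \<open>J\<close> of two or three columns whose excesses are kept exact,
  while every other column is estimated uniformly.\<close>

lemma sum_le_sum_subset_plus:
  fixes x :: "nat \<Rightarrow> 'a::linordered_idom"
  assumes "J \<subseteq> {..<t}" and "\<And>j. j < t \<Longrightarrow> x j \<le> s"
  shows "(\<Sum>j<t. x j) \<le> sum x J + of_nat (t - card J) * s"
proof -
  have "(\<Sum>j<t. x j) = sum x ({..<t} - J) + sum x J"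
    using assms(1) by (intro sum.subset_diff) auto
  also have "sum x ({..<t} - J) \<le> of_nat (card ({..<t} - J)) * s"
    using assms(2) by (intro sum_bounded_above) auto
  also have "card ({..<t} - J) = t - card J"
    using assms(1) by (simp add: card_Diff_subset finite_subset)
  finally show ?thesis by (simp add: add.commute)
qed

lemma entry_le_row_sum:
  assumes "row_sums_eq n r t A" "i < r" "J \<subseteq> {..<t}"
  shows "sum (A i) J \<le> n"
  using sum_mono2[of "{..<t}" J "A i"] assms unfolding row_sums_eq_def by auto

lemma sum_col_sum:
  assumes "row_sums_eq n r t A"
  shows "(\<Sum>j<t. col_sum r A j) = r * n"
proof -
  have "(\<Sum>j<t. col_sum r A j) = (\<Sum>i<r. \<Sum>j<t. A i j)"
    unfolding col_sum_def by (rule sum.swap)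
  then show ?thesis using assms unfolding row_sums_eq_def by simp
qed

text \<open>\<open>Max\<close> is meaningful only on a finite nonempty set; since
  \<open>n > 0\<close>, row \<open>0\<close> has a positive entry.\<close>

lemma D_max_values:
  assumes "row_sums_eq n r t A" "n > 0" "r > 0"
  defines "S \<equiv> {col_sum r A j - A i j | i j. i < r \<and> j < t \<and> A i j > 0}"
  shows "finite S" and "S \<noteq> {}"
proof -
  have "S \<subseteq> (\<lambda>(i, j). col_sum r A j - A i j) ` ({..<r} \<times> {..<t})"
    unfolding S_def by auto
  then show "finite S" by (rule finite_subset) auto
  have "(\<Sum>j<t. A 0 j) > 0" using assms(1-3) unfolding row_sums_eq_def by auto
  then obtain j where "j < t" "A 0 j > 0" by (metis gr0I lessThan_iff sum.neutral less_irrefl)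
  then show "S \<noteq> {}" using assms(3) unfolding S_def by blast
qed

lemma D_max_le_iff:
  assumes "row_sums_eq n r t A" "n > 0" "r > 0"
  shows "D_max r t A \<le> K \<longleftrightarrow> (\<forall>i<r. \<forall>j<t. A i j > 0 \<longrightarrow> col_sum r A j \<le> K + A i j)"
proof -
  have "D_max r t A \<le> K \<longleftrightarrow>
      (\<forall>v\<in>{col_sum r A j - A i j | i j. i < r \<and> j < t \<and> A i j > 0}. v \<le> K)"
    unfolding D_max_def using D_max_values[OF assms] by (rule Max_le_iff)
  also have "\<dots> \<longleftrightarrow> (\<forall>i<r. \<forall>j<t. A i j > 0 \<longrightarrow> col_sum r A j - A i j \<le> K)"
    by blast
  finally show ?thesis by (simp only: le_diff_conv)
qed

lemma D_max_attained:
  assumes "row_sums_eq n r t A" "n > 0" "r > 0"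
  obtains i j where "i < r" "j < t" "A i j > 0" "D_max r t A = col_sum r A j - A i j"
proof -
  have "D_max r t A \<in> {col_sum r A j - A i j | i j. i < r \<and> j < t \<and> A i j > 0}"
    unfolding D_max_def using D_max_values[OF assms] by (rule Max_in)
  then show ?thesis using that by blast
qed

section \<open>Lower bounds for \<open>D_max\<close>\<close>

text \<open>With a support \<open>S\<close> of size at least \<open>m\<close>, adding
  \<open>c \<le> D + b i\<close> over \<open>S\<close> gives
  \<open>(card S - 1) * (c - D) \<le> D\<close>. With a smaller support
  \<open>c \<le> (m - 1) * n\<close>, and the lower bound on \<open>D\<close> takes over. The ring
  is general because both a real and an integer \<open>D\<close> occur later.\<close>

lemma col_excess_le:
  fixes b :: "nat \<Rightarrow> nat" and D :: "'a::linordered_idom"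
  assumes "m \<ge> 2" and "\<And>i. i < r \<Longrightarrow> b i \<le> n" and "D \<ge> 0"
    and b: "\<And>i. i < r \<Longrightarrow> b i > 0 \<Longrightarrow> of_nat (\<Sum>i<r. b i) \<le> D + of_nat (b i)"
    and D: "of_nat ((m - 1)\<^sup>2 * n) \<le> of_nat m * D"
  shows "of_nat (m - 1) * (of_nat (\<Sum>i<r. b i) - D) \<le> D"
proof -
  define S where "S = {i. i < r \<and> b i > 0}"
  define c where "c = (\<Sum>i<r. b i)"
  have fin: "finite S" unfolding S_def by simp
  have c: "c = sum b S"
    unfolding c_def S_def by (rule sum.mono_neutral_right) auto
  show ?thesis
  proof (cases "card S \<ge> m")
    case True
    \<comment> \<open>For \<open>c > D\<close> the factor \<open>card S - 1\<close> may be lowered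
      to \<open>m - 1\<close>; for \<open>c \<le> D\<close> the left side is nonpositive.\<close>
    show ?thesis
    proof (cases "of_nat c \<le> D")
      case True
      then have "of_nat (m - 1) * (of_nat c - D) \<le> 0" by (simp add: mult_nonneg_nonpos)
      then show ?thesis using assms(3) unfolding c_def by linarith
    next
      case False
      have "of_nat (card S) * of_nat c \<le> (\<Sum>i\<in>S. D + of_nat (b i))"
        using b by (intro sum_bounded_below) (auto simp: S_def c_def)
      also have "\<dots> = of_nat (card S) * D + of_nat c"
        by (simp add: sum.distrib c)
      finally have "(of_nat (card S) - 1) * (of_nat c - D) \<le> D"
        by (simp add: algebra_simps)
      moreover have "of_nat (m - 1) \<le> (of_nat (card S) - 1 :: 'a)"
        using True assms(1) by (simp add: of_nat_diff)
      ultimately show ?thesis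
        using False mult_right_mono[of "of_nat (m - 1)" "of_nat (card S) - 1" "of_nat c - D"]
        unfolding c_def by (smt (verit) diff_ge_0_iff_ge linorder_linear order_trans)
    qed
  next
    case False
    have "c \<le> card S * n" unfolding c using assms(2) sum_bounded_above[of S b n]
      by (auto simp: S_def)
    also have "\<dots> \<le> (m - 1) * n" using False by (intro mult_right_mono) auto
    finally have "of_nat c \<le> (of_nat ((m - 1) * n) :: 'a)" by (rule of_nat_mono)
    then have "of_nat (m - 1) * (of_nat c :: 'a) \<le> of_nat (m - 1) * of_nat ((m - 1) * n)"
      by (intro mult_left_mono) auto
    also have "\<dots> = of_nat ((m - 1)\<^sup>2 * n)"
      by (simp only: of_nat_mult [symmetric] power2_eq_square mult.assoc)
    also note D
    finally show ?thesis using assms(1) unfolding c_def by (simp add: of_nat_diff algebra_simps)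
  qed
qed

text \<open>If no row is split, all entries are \<open>0\<close> or \<open>n\<close>, so that the column sums, being multiples of \<open>n\<close> below
  \<open>m * n\<close>, add up to at most \<open>(m - 1) * t * n < r * n\<close>.\<close>

lemma split_row_exists:
  assumes A: "row_sums_eq n r t A" and "n > 0" "m \<ge> 1" "(m - 1) * t < r"
    and "D_max r t A < (m - 1) * n"
  obtains i p q where "i < r" "p < t" "q < t" "p \<noteq> q" "A i p > 0" "A i q > 0"
proof (rule ccontr)
  assume "\<not> thesis"
  with that have single: "A i q = 0" if "i < r" "p < t" "q < t" "p \<noteq> q" "A i p > 0" for i p q
    using \<open>i < r\<close> \<open>p < t\<close> \<open>q < t\<close> \<open>p \<noteq> q\<close> \<open>A i p > 0\<close> by blast
  have full: "A i p = n" if "i < r" "p < t" "A i p > 0" for i p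
  proof -
    have "n = (\<Sum>j<t. A i j)" using A that unfolding row_sums_eq_def by auto
    also have "\<dots> = (\<Sum>j\<in>{p}. A i j)"
      using that single[OF that(1,2) _ _ that(3)] by (intro sum.mono_neutral_right) auto
    finally show ?thesis by simp
  qed
  have "col_sum r A j \<le> (m - 1) * n" if "j < t" for j
  proof (cases "\<exists>i<r. A i j > 0")
    case True
    then obtain i where i: "i < r" "A i j > 0" by blast
    have "col_sum r A j \<le> D_max r t A + A i j"
      using D_max_le_iff[OF A \<open>n > 0\<close>, of "D_max r t A"] i that by auto
    then have lt: "col_sum r A j < m * n"
      using assms full[OF i(1) that i(2)] by (cases m) auto
    have "n dvd col_sum r A j" unfolding col_sum_def
      by (rule dvd_sum) (metis dvd_0_right dvd_refl full gr0I lessThan_iff that)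
    then obtain k where k: "col_sum r A j = k * n" by (metis dvd_def mult.commute)
    then have "k < m" using lt by auto
    then show ?thesis unfolding k by (intro mult_right_mono) auto
  next
    case False
    then show ?thesis unfolding col_sum_def by auto
  qed
  then have "(\<Sum>j<t. col_sum r A j) \<le> t * ((m - 1) * n)"
    using sum_bounded_above[of "{..<t}" "col_sum r A" "(m - 1) * n"] by auto
  then have "r * n \<le> ((m - 1) * t) * n" using sum_col_sum[OF A] by (simp add: mult_ac)
  then show False using assms by simp
qed

lemma col_excess_le_threshold:
  fixes D :: "'a::linordered_idom"
  assumes A: "row_sums_eq n r t A" and "n > 0" "m \<ge> 2"
    and "of_nat (D_max r t A) \<le> D" and "of_nat ((m - 1)\<^sup>2 * n) \<le> of_nat m * D"
    and "j < t"
  shows "of_nat (m - 1) * (of_nat (col_sum r A j) - D) \<le> D"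
  unfolding col_sum_def
proof (rule col_excess_le)
  show "A i j \<le> n" if "i < r" for i
    using entry_le_row_sum[OF A that, of "{j}"] \<open>j < t\<close> by auto
  show "0 \<le> D" using assms(4) by (meson of_nat_0_le_iff order_trans)
  show "of_nat (\<Sum>i<r. A i j) \<le> D + of_nat (A i j)" if "i < r" "A i j > 0" for i
  proof -
    have "col_sum r A j \<le> D_max r t A + A i j"
      using D_max_le_iff[OF A \<open>n > 0\<close>, of "D_max r t A"] that \<open>j < t\<close> by auto
    then have "of_nat (col_sum r A j) \<le> (of_nat (D_max r t A) + of_nat (A i j) :: 'a)"
      by (metis of_nat_add of_nat_mono)
    then show ?thesis using assms(4) unfolding col_sum_def by simp
  qed
qed (use assms in auto)

text \<open>The two entries share a row of sum \<open>n\<close>, and each is at least its column sum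
  minus \<open>D_max\<close>.\<close>

lemma split_row_excess:
  assumes A: "row_sums_eq n r t A" and "n > 0"
    and "i < r" "p < t" "q < t" "p \<noteq> q" "A i p > 0" "A i q > 0"
  shows "col_sum r A p + col_sum r A q \<le> n + 2 * D_max r t A"
proof -
  have "A i p + A i q \<le> n"
    using entry_le_row_sum[OF A, of i "{p, q}"] assms by auto
  moreover have "col_sum r A p \<le> D_max r t A + A i p" "col_sum r A q \<le> D_max r t A + A i q"
    using D_max_le_iff[OF A \<open>n > 0\<close>, of "D_max r t A"] assms by auto
  ultimately show ?thesis by linarith
qed

text \<open>Supplies what \<open>col_excess_le\<close> needs for small supports. The difference
  \<open>m * (r - 1) - (m - 1) * (m * t - 2)\<close> equals \<open>m * (t - a + 1) - 2\<close>,
  which is positive because \<open>a \<le> t - 1\<close>.\<close>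

lemma threshold_large:
  fixes D :: "'a::linordered_idom"
  assumes "m \<ge> 2" "t \<ge> 2" "a \<le> t - 1" and r: "r + a = m * t"
    and D: "(of_nat m - 1) * (of_nat r - 1) * of_nat n \<le> (of_nat m * of_nat t - 2) * D"
  shows "of_nat ((m - 1)\<^sup>2 * n) \<le> of_nat m * D"
proof -
  define M R N \<mu> :: 'a where "M = of_nat m" and "R = of_nat r" and "N = of_nat n" and "\<mu> = M * of_nat t - 2"
  have R: "R = M * of_nat t - of_nat a"
    using r unfolding R_def M_def by (metis add_diff_cancel_right' of_nat_add of_nat_mult)
  have M: "M \<ge> 2" unfolding M_def using of_nat_mono[OF assms(1), where 'a = 'a] by simp
  have t2: "of_nat t \<ge> (2 :: 'a)" using of_nat_mono[OF assms(2), where 'a = 'a] by simp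
  have ta: "of_nat t - of_nat a \<ge> (1 :: 'a)"
  proof -
    have "of_nat (a + 1) \<le> (of_nat t :: 'a)" using assms by (intro of_nat_mono) auto
    then show ?thesis by (simp add: algebra_simps)
  qed
  have "M * of_nat t \<ge> 2 * 2" using M t2 by (intro mult_mono) auto
  then have pos: "\<mu> > 0" unfolding \<mu>_def by (rule less_le_trans[rotated, OF diff_right_mono]) simp
  have "M * (of_nat t - of_nat a + 1) \<ge> 2 * 2"
    using M ta by (intro mult_mono) (auto simp: algebra_simps)
  then have "(M - 1) * \<mu> \<le> M * (R - 1)"
    unfolding R \<mu>_def by (simp add: algebra_simps)
  then have "((M - 1) * N) * ((M - 1) * \<mu>) \<le> ((M - 1) * N) * (M * (R - 1))"
    using M unfolding N_def by (intro mult_left_mono) auto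
  also have "\<dots> = M * ((M - 1) * (R - 1) * N)" by (simp add: mult_ac)
  also have "\<dots> \<le> M * (\<mu> * D)"
    using D M unfolding M_def R_def N_def \<mu>_def by (intro mult_left_mono) auto
  finally have "\<mu> * ((M - 1)\<^sup>2 * N) \<le> \<mu> * (M * D)"
    by (simp add: power2_eq_square mult_ac)
  then have "(M - 1)\<^sup>2 * N \<le> M * D" using pos by simp
  then show ?thesis using assms(1) unfolding M_def N_def by (simp add: of_nat_diff)
qed

text \<open>This is the bound before rounding up. Estimating the total excess by \<open>n\<close>
  for a split pair and by \<open>D / (m - 1)\<close> for each other column balances exactly at the
  real threshold \<open>D\<close>.\<close>

lemma D_max_threshold:
  assumes A: "row_sums_eq n r t A" and "n > 0" "m \<ge> 2" "t \<ge> 2" "a \<ge> 2" "a \<le> t - 1"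
    and r: "r + a = m * t"
  shows "(int m - 1) * (int r - 1) * int n \<le> (int m * int t - 2) * int (D_max r t A)"
proof (rule ccontr)
  define K where "K = D_max r t A"
  define D where "D = (real m - 1) * (real r - 1) * real n / (real m * real t - 2)"
  assume "\<not> ?thesis"
  then have "(int m * int t - 2) * int K < (int m - 1) * (int r - 1) * int n"
    unfolding K_def by simp
  then have "real_of_int ((int m * int t - 2) * int K) < real_of_int ((int m - 1) * (int r - 1) * int n)"
    by (simp only: of_int_less_iff)
  then have less: "(real m * real t - 2) * real K < (real m - 1) * (real r - 1) * real n" by simp
  have mt: "m * t \<ge> 2 * t" using assms by (intro mult_right_mono) auto
  have rr: "real r = real m * real t - real a" using r by (metis add_diff_cancel_right' of_nat_add of_nat_mult)
  have pos: "real m * real t - 2 > 0"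
  proof -
    have "real (m * t) \<ge> real (2 * t)" using mt by (rule of_nat_mono)
    then have "real m * real t \<ge> 2 * real t" by simp
    then show ?thesis using assms(4) by linarith
  qed
  have KD: "real K < D" using less pos unfolding D_def by (simp add: pos_less_divide_eq mult_ac)
  have Deq: "(real m * real t - 2) * D = (real m - 1) * (real r - 1) * real n"
    using pos unfolding D_def by simp
  have thr: "real ((m - 1)\<^sup>2 * n) \<le> real m * D"
    using threshold_large[of m t a r n D] assms Deq by simp
  have "(m - 1) * t = m * t - t" by (simp add: diff_mult_distrib)
  then have "(m - 1) * t < r" using r mt assms(4,6) by linarith
  \<comment> \<open>From \<open>r - 1 \<le> m * t - 2\<close> follows
    \<open>D \<le> (m - 1) * n\<close>, so a split row exists.\<close>
  moreover have "K < (m - 1) * n"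
  proof -
    have "real a \<ge> 2" using assms by simp
    then have "((real m - 1) * real n) * (real r - 1) \<le> ((real m - 1) * real n) * (real m * real t - 2)"
      using assms unfolding rr by (intro mult_left_mono) auto
    then have "(real m * real t - 2) * D \<le> (real m * real t - 2) * ((real m - 1) * real n)"
      unfolding Deq by (simp add: mult_ac)
    then have "real K < real ((m - 1) * n)" using KD pos assms by (simp add: of_nat_diff)
    then show ?thesis by (simp only: of_nat_less_iff)
  qed
  ultimately obtain i p q where pq: "i < r" "p < t" "q < t" "p \<noteq> q" "A i p > 0" "A i q > 0"
    using split_row_exists[OF A] assms unfolding K_def by (metis One_nat_def Suc_leD numeral_2_eq_2)
  define x where "x j = (real m - 1) * (real (col_sum r A j) - D)" for j
  have xle: "x j \<le> D" if "j < t" for j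
    using col_excess_le_threshold[OF A, of m D j] assms KD thr that
    unfolding x_def K_def by (simp add: of_nat_diff)
  have "real (col_sum r A p + col_sum r A q) \<le> real (n + 2 * K)"
    using split_row_excess[OF A _ pq] assms unfolding K_def by (intro of_nat_mono) auto
  then have "real (col_sum r A p) - D + (real (col_sum r A q) - D) < real n" using KD by simp
  then have "(real m - 1) * (real (col_sum r A p) - D + (real (col_sum r A q) - D)) < (real m - 1) * real n"
    using assms by (intro mult_strict_left_mono) auto
  then have "x p + x q < (real m - 1) * real n" unfolding x_def by (simp add: algebra_simps)
  moreover have "(\<Sum>j<t. x j) \<le> x p + x q + (real t - 2) * D"
    using sum_le_sum_subset_plus[of "{p, q}" t x D] xle pq assms by (simp add: of_nat_diff)
  moreover have "(\<Sum>j<t. x j) = (real m - 1) * (real r * real n - real t * D)"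
  proof -
    have "real (\<Sum>j<t. col_sum r A j) = real r * real n" using sum_col_sum[OF A] by simp
    then show ?thesis unfolding x_def by (simp add: sum_subtractf flip: sum_distrib_left)
  qed
  ultimately have "(real m - 1) * (real r * real n - real t * D) < (real m - 1) * real n + (real t - 2) * D"
    by linarith
  then show False using Deq by (simp add: algebra_simps)
qed

text \<open>For an integral \<open>d\<close> each column excess can be rounded down to
  \<open>s\<close>, which sharpens the count; the second conclusion is its equality case.\<close>

lemma split_row_bound:
  fixes d s :: int
  assumes A: "row_sums_eq n r t A" and "n > 0" "m \<ge> 2" "t \<ge> 3" "(m - 1) * t < r"
    and D: "int (D_max r t A) \<le> d" and "d < int ((m - 1) * n)"
    and thr: "int ((m - 1)\<^sup>2 * n) \<le> int m * d"
    and s: "s = d div int (m - 1)"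
  defines "H \<equiv> int n + int t * d + (int t - 2) * s - int r * int n"
  shows "H \<ge> 0"
    and "H = 0 \<Longrightarrow> \<exists>j<t. int (col_sum r A j) = d + s \<and> (\<forall>i<r. A i j > 0 \<longrightarrow> A i j = n \<or> int (A i j) = s)"
proof -
  define x where "x j = int (col_sum r A j) - d" for j
  have xle: "x j \<le> s" if "j < t" for j
  proof -
    have "int (m - 1) * x j \<le> d"
      using col_excess_le_threshold[OF A, of m d j] assms that unfolding x_def by simp
    then have "(int (m - 1) * x j) div int (m - 1) \<le> d div int (m - 1)"
      using \<open>m \<ge> 2\<close> by (intro zdiv_mono1) auto
    then show ?thesis unfolding s using \<open>m \<ge> 2\<close> by simp
  qed
  have sumx: "(\<Sum>j<t. x j) = int r * int n - int t * d"
  proof -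
    have "int (\<Sum>j<t. col_sum r A j) = int r * int n" using sum_col_sum[OF A] by simp
    then show ?thesis unfolding x_def by (simp add: sum_subtractf)
  qed
  have ex: "col_sum r A j \<le> D_max r t A + A i j" if "i < r" "j < t" "A i j > 0" for i j
    using D_max_le_iff[OF A \<open>n > 0\<close>, of "D_max r t A"] that by auto
  have two: "x p + x q \<le> n" if "i < r" "p < t" "q < t" "p \<noteq> q" "A i p > 0" "A i q > 0" for i p q
    using split_row_excess[OF A _ that] assms(2) D unfolding x_def by linarith
  have "D_max r t A < (m - 1) * n" using D assms(7) by linarith
  then obtain i p q where pq: "i < r" "p < t" "q < t" "p \<noteq> q" "A i p > 0" "A i q > 0"
    using split_row_exists[OF A, of m] assms by (metis One_nat_def Suc_leD numeral_2_eq_2)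
  have "(\<Sum>j<t. x j) \<le> x p + x q + (int t - 2) * s"
    using sum_le_sum_subset_plus[of "{p, q}" t x s] xle pq assms by (simp add: of_nat_diff)
  then show "H \<ge> 0" using two[OF pq] sumx unfolding H_def by linarith
  assume H: "H = 0"
  \<comment> \<open>\<open>t \<ge> 3\<close> supplies a third column. With \<open>H = 0\<close> the
    estimate has no slack, so the excess of that column must be \<open>s\<close>.\<close>
  have "card {p, q} < card {..<t}" using assms(4) by (simp add: card_insert_if)
  then obtain j where j: "j < t" "j \<noteq> p" "j \<noteq> q"
    by (metis card_mono finite.emptyI finite.insertI insertCI lessThan_iff not_le subsetI)
  have "(\<Sum>j<t. x j) \<le> x p + x q + x j + (int t - 3) * s"
    using sum_le_sum_subset_plus[of "{p, q, j}" t x s] xle pq j assms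
    by (simp add: of_nat_diff)
  then have "x j \<ge> s" using two[OF pq] sumx H unfolding H_def by (simp add: algebra_simps)
  then have xj: "x j = s" using xle j by (simp add: order_antisym)
  have "A i' j = n \<or> int (A i' j) = s" if i': "i' < r" "A i' j > 0" for i'
  proof (cases "\<exists>u<t. u \<noteq> j \<and> A i' u > 0")
    case True
    then obtain u where u: "u < t" "u \<noteq> j" "A i' u > 0" by blast
    \<comment> \<open>The same count for the pair \<open>j\<close>, \<open>u\<close> gives
      \<open>x j + x u \<ge> n\<close>. The two entries are at least these excesses and add up to at
      most \<open>n\<close>, so equality holds for both.\<close>
    have "(\<Sum>j<t. x j) \<le> x j + x u + (int t - 2) * s"
      using sum_le_sum_subset_plus[of "{j, u}" t x s] xle u j assms by (simp add: of_nat_diff)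
    then have "x j + x u \<ge> n" using sumx H unfolding H_def by linarith
    moreover have "A i' j + A i' u \<le> n"
      using entry_le_row_sum[OF A i'(1), of "{j, u}"] u j by auto
    moreover have "x j \<le> A i' j" "x u \<le> A i' u"
      using ex[OF i'(1) j(1) i'(2)] ex[OF i'(1) u(1,3)] D unfolding x_def by linarith+
    ultimately show ?thesis using xj by linarith
  next
    case False
    have "n = (\<Sum>u<t. A i' u)" using A i' unfolding row_sums_eq_def by auto
    also have "\<dots> = (\<Sum>u\<in>{j}. A i' u)"
      using False j by (intro sum.mono_neutral_right) auto
    finally show ?thesis by simp
  qed
  then show "\<exists>j<t. int (col_sum r A j) = d + s \<and> (\<forall>i<r. A i j > 0 \<longrightarrow> A i j = n \<or> int (A i j) = s)"
    using j(1) xj unfolding x_def by (intro exI[of _ j]) auto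
qed

section \<open>The column equation in the case \<open>H = 0\<close>\<close>

lemma sum_two_valued:
  fixes b :: "nat \<Rightarrow> nat"
  assumes "\<And>i. i < r \<Longrightarrow> b i > 0 \<Longrightarrow> b i = n \<or> int (b i) = s"
  shows "\<exists>e f. int (\<Sum>i<r. b i) = int e * int n + int f * s"
  using assms
proof (induction r)
  case 0
  show ?case by (intro exI[of _ 0]) simp
next
  case (Suc r)
  obtain e f :: nat where ef: "int (\<Sum>i<r. b i) = int e * int n + int f * s"
    using Suc by auto
  consider "b r = 0" | "b r = n" | "int (b r) = s" using Suc.prems[of r] by auto
  then show ?case
  proof cases
    case 1
    then show ?thesis using ef by auto
  next
    case 2
    then show ?thesis using ef by (intro exI[of _ "Suc e"] exI[of _ f]) (simp add: algebra_simps)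
  next
    case 3
    then show ?thesis using ef by (intro exI[of _ e] exI[of _ "Suc f"]) (simp add: algebra_simps)
  qed
qed

text \<open>Only \<open>e + f = m\<close> is compatible with the sizes of \<open>s\<close> and \<open>T\<close>, unless \<open>n - s = 1\<close>.\<close>

lemma tight_column_dvd:
  fixes m t a n s T e f :: int
  assumes "m \<ge> 2" "t \<ge> 3" "2 \<le> a" "a \<le> m" "a \<le> t - 1" "0 \<le> T" "T \<le> m - 2" "0 \<le> s" "s < n"
    and "e \<ge> 0" "f \<ge> 0"
    and col: "e * n + f * s = m * s + T"
    and low: "(m - 1) * n \<le> m * s + T"
    and H: "n + t * ((m - 1) * s + T) + (t - 2) * s = (m * t - a) * n"
  shows "(n - s) dvd T"
proof (cases "n - s = 1")
  case False
  define g where "g = n - s"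
  have g2: "g \<ge> 2" using False assms unfolding g_def by linarith
  have n: "n = s + g" unfolding g_def by simp
  \<comment> \<open>This is the equation \<open>H\<close> after substituting
    \<open>n = s + g\<close>; the terms \<open>m * t * s\<close> cancel.\<close>
  have bal: "(m * t - a - 1) * g = t * T + (a - 1) * s"
    using H unfolding n by (simp add: algebra_simps)
  \<comment> \<open>With \<open>g \<ge> 2\<close> the left side of \<open>bal\<close> is too large
    for \<open>s\<close> and \<open>T\<close> both at most \<open>m - 2\<close>.\<close>
  have sbig: "s > m - 2"
  proof (rule ccontr)
    assume "\<not> s > m - 2"
    then have "(a - 1) * s \<le> (t - 2) * (m - 2)"
      using assms by (intro mult_mono) auto
    moreover have "t * T \<le> t * (m - 2)" using assms by (intro mult_left_mono) auto
    moreover have "m * t \<ge> m * (a + 1)" using assms by (intro mult_left_mono) auto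
    moreover have "m * t \<ge> 2 * t" using assms by (intro mult_right_mono) auto
    moreover have "m * t - a - 1 \<ge> 0" using calculation(4) assms by linarith
    then have "(m * t - a - 1) * 2 \<le> (m * t - a - 1) * g" using g2 by (intro mult_left_mono)
    ultimately show False using bal assms by (simp add: algebra_simps)
  qed
  have col': "e * g + (e + f - m) * s = T" using col unfolding n by (simp add: algebra_simps)
  \<comment> \<open>\<open>e + f = m\<close> leaves \<open>e * g = T\<close>. More entries cost an
    additional \<open>s > T\<close>; fewer force equality in \<open>low\<close>, which contradicts
    \<open>bal\<close>.\<close>
  consider "e + f = m" | "e + f \<ge> m + 1" | "e + f \<le> m - 1" by linarith
  then show ?thesis
  proof cases
    case 1
    then show ?thesis using col' unfolding g_def by (metis diff_self mult_zero_left add_0_right dvd_triv_right)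
  next
    case 2
    then have "1 * s \<le> (e + f - m) * s" using assms by (intro mult_right_mono) auto
    moreover have "e * g \<ge> 0" using assms g2 by auto
    ultimately show ?thesis using col' sbig assms by linarith
  next
    case 3
    have "e * n + f * s \<le> e * n + f * n" using assms by (intro add_left_mono mult_left_mono) auto
    also have "\<dots> = (e + f) * n" by (simp add: algebra_simps)
    also have "\<dots> \<le> (m - 1) * n" using 3 assms by (intro mult_right_mono) auto
    finally have "(m - 1) * n = m * s + T" using col low by linarith
    then have sT: "s = (m - 1) * g - T" unfolding n by (simp add: algebra_simps)
    \<comment> \<open>\<open>w\<close> is the coefficient of \<open>T\<close> once \<open>s\<close>
      is eliminated from \<open>bal\<close>; \<open>a \<le> t - 1\<close> makes it at least
      \<open>2\<close>.\<close>
    define w where "w = t - a + 1"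
    have t: "t = w + a - 1" unfolding w_def by simp
    have w2: "w \<ge> 2" unfolding w_def using assms by linarith
    have eq: "(m * w - 2) * g = w * T"
      using bal unfolding sT t by (simp add: algebra_simps)
    have "m * w \<ge> 2 * 2" using w2 assms by (intro mult_mono) auto
    then have "(m * w - 2) * 1 \<le> (m * w - 2) * g" using g2 by (intro mult_left_mono) auto
    moreover have "w * T \<le> w * (m - 2)" using assms w2 by (intro mult_left_mono) auto
    ultimately show ?thesis using eq w2 by (simp add: algebra_simps)
  qed
qed simp

section \<open>Matrices attaining the bound\<close>

lemma sum_div_mod_block:
  fixes w :: "nat \<Rightarrow> 'a::comm_monoid_add"
  assumes "m > 0" "(q + 1) * m \<le> r"
  shows "(\<Sum>i<r. if i div m = q then w (i mod m) else 0) = sum w {..<m}"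
proof -
  have "(\<Sum>i<r. if i div m = q then w (i mod m) else 0) = (\<Sum>i\<in>{i. i < r \<and> i div m = q}. w (i mod m))"
    by (rule sum.mono_neutral_cong_right) auto
  also have "{i. i < r \<and> i div m = q} = (\<lambda>l. q * m + l) ` {..<m}"
  proof (intro equalityI subsetI)
    fix i assume "i \<in> {i. i < r \<and> i div m = q}"
    then have "i = q * m + i mod m" "i mod m < m" using assms by auto
    then show "i \<in> (\<lambda>l. q * m + l) ` {..<m}" by blast
  qed (use assms in auto)
  also have "(\<Sum>i\<in>\<dots>. w (i mod m)) = sum w {..<m}"
    by (subst sum.reindex) (auto simp: inj_on_def)
  finally show ?thesis .
qed

text \<open>Column \<open>q + 1\<close> carries the weights \<open>w\<close> in the block of rows \<open>q * m, \<dots>, q * m + m - 1\<close>, and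
  column \<open>0\<close> takes up the remainder of every row; the last \<open>b\<close> rows lie entirely in column \<open>0\<close>.\<close>

lemma block_matrix_exists:
  fixes w :: "nat \<Rightarrow> nat"
  assumes "m > 0" "n > 0" "u > 0" and r: "r = m * u + b"
    and wn: "\<And>l. l < m \<Longrightarrow> w l \<le> n"
    and C: "sum w {..<m} = C"
    and colq: "\<And>l. l < m \<Longrightarrow> w l > 0 \<Longrightarrow> C \<le> d + w l"
    and col0: "\<And>l. l < m \<Longrightarrow> w l < n \<Longrightarrow> r * n \<le> d + (n - w l) + u * C"
    and pure: "r * n \<le> d + n + u * C"
  shows "\<exists>A. row_sums_eq n r (Suc u) A \<and> D_max r (Suc u) A \<le> d"
proof -
  define A where "A i j = (case j of 0 \<Rightarrow> (if i < m * u then n - w (i mod m) else n)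
      | Suc q \<Rightarrow> if i div m = q then w (i mod m) else 0)" for i j
  have rows: "row_sums_eq n r (Suc u) A"
    unfolding row_sums_eq_def
  proof (intro allI impI)
    fix i
    have "(\<Sum>j<Suc u. A i j) = A i 0 + (\<Sum>q<u. if i div m = q then w (i mod m) else 0)"
      by (subst sum.lessThan_Suc_shift) (simp add: A_def)
    also have "\<dots> = n"
    proof (cases "i < m * u")
      case True
      then have "i div m < u" by (simp add: less_mult_imp_div_less mult.commute)
      then show ?thesis using True wn[of "i mod m"] \<open>m > 0\<close> by (simp add: A_def)
    next
      case False
      then have "\<not> i div m < u" using \<open>m > 0\<close> by (simp add: div_less_iff_less_mult mult.commute)
      then show ?thesis using False by (simp add: A_def)
    qed
    finally show "(\<Sum>j<Suc u. A i j) = n" .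
  qed
  have cq: "col_sum r A (Suc q) = C" if "q < u" for q
  proof -
    have "(q + 1) * m \<le> u * m" using that by (intro mult_right_mono) auto
    then show ?thesis using sum_div_mod_block[of m q r w] assms
      by (simp add: col_sum_def A_def mult.commute)
  qed
  \<comment> \<open>The total \<open>r * n\<close> determines column \<open>0\<close>. This turns
    \<open>col0\<close> into the bound for rows shared with a block, and \<open>pure\<close> into
    that for rows lying entirely in column \<open>0\<close>.\<close>
  have c0: "col_sum r A 0 + u * C = r * n"
    using sum_col_sum[OF rows] cq by (simp add: sum.lessThan_Suc_shift del: sum.lessThan_Suc)
  have "r > 0" using assms by auto
  have "col_sum r A j \<le> d + A i j" if "i < r" "j < Suc u" "A i j > 0" for i j
  proof (cases j)
    case 0
    show ?thesis
    proof (cases "i < m * u")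
      case True
      then show ?thesis using col0[of "i mod m"] that 0 c0 \<open>m > 0\<close> by (simp add: A_def)
    next
      case False
      then show ?thesis using pure 0 c0 by (simp add: A_def)
    qed
  next
    case (Suc q)
    then have "i div m = q" "w (i mod m) > 0" "A i j = w (i mod m)"
      using that by (auto simp: A_def split: if_splits)
    then show ?thesis using colq[of "i mod m"] cq[of q] Suc that \<open>m > 0\<close> by simp
  qed
  then have "D_max r (Suc u) A \<le> d" using D_max_le_iff[OF rows \<open>n > 0\<close> \<open>r > 0\<close>] by blast
  then show ?thesis using rows by blast
qed

text \<open>Raising \<open>T\<close> of the \<open>m\<close> weights \<open>s\<close> to
  \<open>s + 1\<close> makes a block sum to \<open>m * s + T = d + s\<close>. A weight
  \<open>s + 1\<close> costs column \<open>0\<close> one unit, paid for by the strict inequality in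
  \<open>slack\<close>.\<close>

lemma matrix_exists_slack:
  fixes m n t a r d s T :: nat
  assumes "n > 0" "m \<ge> 2" "t \<ge> 2" "a \<le> m" "r + a = m * t" and d: "d = (m - 1) * s + T"
    and "T \<le> m" "s \<le> n" "T > 0 \<Longrightarrow> s < n"
    and slack: "r * n < n + t * d + (t - 2) * s"
  shows "\<exists>A. row_sums_eq n r t A \<and> D_max r t A \<le> d"
proof -
  obtain u where t: "t = Suc (Suc u)" using assms(3) by (metis Suc_le_D numeral_2_eq_2 Suc_le_mono)
  define w where "w l = s + (if l < T then 1 else 0)" for l :: nat
  have "(\<Sum>l<m. if l < T then 1 else 0 :: nat) = card {l. l < m \<and> l < T}"
    by (simp add: sum.If_cases lessThan_def Collect_conj_eq [symmetric])
  also have "{l. l < m \<and> l < T} = {..<T}" using assms by auto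
  finally have C: "sum w {..<m} = d + s"
    using assms(2) unfolding w_def d by (cases m) (auto simp: sum.distrib)
  have "\<exists>A. row_sums_eq n r (Suc (Suc u)) A \<and> D_max r (Suc (Suc u)) A \<le> d"
  \<comment> \<open>The \<open>t - 1\<close> blocks of \<open>m\<close> rows leave
    \<open>m - a\<close> rows for column \<open>0\<close> alone.\<close>
  proof (rule block_matrix_exists[of m n "Suc u" r "m - a" w "d + s" d])
    show "w l \<le> n" if "l < m" for l using assms unfolding w_def by auto
    show "r * n \<le> d + (n - w l) + Suc u * (d + s)" if "l < m" "w l < n" for l
      using slack assms that unfolding t w_def by (auto simp: algebra_simps)
    show "r * n \<le> d + n + Suc u * (d + s)"
      using slack unfolding t by (simp add: algebra_simps)
  qed (use assms t C in \<open>auto simp: w_def\<close>)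
  then show ?thesis unfolding t .
qed

text \<open>Without slack no weight may lie strictly between \<open>s\<close> and \<open>n\<close>,
  so \<open>T\<close> is spent in jumps of \<open>n - s\<close>. Rows of weight \<open>n\<close>
  leave column \<open>0\<close> empty, and rows of weight \<open>s\<close> meet the bound with
  equality.\<close>

lemma matrix_exists_tight:
  fixes m n t a r d s T :: nat
  assumes "n > 0" "m \<ge> 2" "t \<ge> 2" "a \<le> m" "r + a = m * t" and d: "d = (m - 1) * s + T"
    and "T \<le> m" "s < n" and dvd: "(n - s) dvd T"
    and tight: "r * n = n + t * d + (t - 2) * s"
  shows "\<exists>A. row_sums_eq n r t A \<and> D_max r t A \<le> d"
proof -
  obtain u where t: "t = Suc (Suc u)" using assms(3) by (metis Suc_le_D numeral_2_eq_2 Suc_le_mono)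
  obtain e where e: "T = (n - s) * e" using dvd by (rule dvdE)
  have "1 * e \<le> (n - s) * e" using assms by (intro mult_right_mono) auto
  then have em: "e \<le> m" using e \<open>T \<le> m\<close> by linarith
  define w where "w l = s + (if l < e then n - s else 0)" for l :: nat
  have "(\<Sum>l<m. if l < e then n - s else 0) = (n - s) * card {l. l < m \<and> l < e}"
    by (simp add: sum.If_cases lessThan_def Collect_conj_eq [symmetric])
  also have "{l. l < m \<and> l < e} = {..<e}" using em by auto
  finally have C: "sum w {..<m} = d + s"
    using assms(2) e unfolding w_def d by (cases m) (auto simp: sum.distrib)
  have "\<exists>A. row_sums_eq n r (Suc (Suc u)) A \<and> D_max r (Suc (Suc u)) A \<le> d"
  proof (rule block_matrix_exists[of m n "Suc u" r "m - a" w "d + s" d])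
    show "w l \<le> n" if "l < m" for l using assms unfolding w_def by auto
    show "r * n \<le> d + (n - w l) + Suc u * (d + s)" if "l < m" "w l < n" for l
      using tight assms(8) that unfolding t w_def by (auto simp: algebra_simps split: if_splits)
    show "r * n \<le> d + n + Suc u * (d + s)"
      using tight unfolding t by (simp add: algebra_simps)
  qed (use assms t C in \<open>auto simp: w_def\<close>)
  then show ?thesis unfolding t .
qed

section \<open>Passing between coloured graphs and matrices\<close>

lemma card_partition_by:
  assumes "finite V" "g ` V \<subseteq> T" "finite T"
  shows "card V = (\<Sum>y\<in>T. card {v \<in> V. g v = y})"
  using sum.group[of V T g "\<lambda>_. 1::nat"] assms by simp

text \<open>\<open>col_sum r A j - A i j\<close> counts the vertices of colour \<open>j\<close>
  outside class \<open>i\<close>; adding those of other colours gives everything outside class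
  \<open>i\<close>.\<close>

lemma card_other_class_other_colour:
  fixes p f :: "'a \<Rightarrow> nat"
  assumes "finite V" "p ` V \<subseteq> {..<r}"
    and cls: "\<And>i. i < r \<Longrightarrow> card {v \<in> V. p v = i} = n"
    and A: "\<And>i j. A i j = card {v \<in> V. p v = i \<and> f v = j}"
    and "i < r"
  shows "card {u \<in> V. p u \<noteq> i \<and> f u \<noteq> j} + (col_sum r A j - A i j) = (r - 1) * n"
proof -
  have "card {u \<in> V. f u = j} = (\<Sum>i<r. card {v \<in> {u \<in> V. f u = j}. p v = i})"
    using assms(1,2) by (intro card_partition_by) auto
  then have col: "col_sum r A j = card {u \<in> V. f u = j}"
    unfolding col_sum_def A by (simp add: conj_ac)
  have "{u \<in> V. f u = j} = {u \<in> V. p u \<noteq> i \<and> f u = j} \<union> {u \<in> V. p u = i \<and> f u = j}" by auto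
  then have 1: "card {u \<in> V. f u = j} = card {u \<in> V. p u \<noteq> i \<and> f u = j} + card {u \<in> V. p u = i \<and> f u = j}"
    using assms(1) by (simp only:) (rule card_Un_disjoint; auto)
  have "V = {u \<in> V. p u \<noteq> i} \<union> {u \<in> V. p u = i}" by auto
  then have "card V = card {u \<in> V. p u \<noteq> i} + card {u \<in> V. p u = i}"
    using assms(1) card_Un_disjoint[of "{u \<in> V. p u \<noteq> i}" "{u \<in> V. p u = i}"] by auto
  moreover have "card V = r * n" using card_partition_by[OF assms(1,2)] cls by simp
  ultimately have 2: "card {u \<in> V. p u \<noteq> i} = (r - 1) * n"
    using cls[OF \<open>i < r\<close>] by (simp add: diff_mult_distrib)
  have "{u \<in> V. p u \<noteq> i} = {u \<in> V. p u \<noteq> i \<and> f u \<noteq> j} \<union> {u \<in> V. p u \<noteq> i \<and> f u = j}" by auto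
  then have "card {u \<in> V. p u \<noteq> i} = card {u \<in> V. p u \<noteq> i \<and> f u \<noteq> j} + card {u \<in> V. p u \<noteq> i \<and> f u = j}"
    using assms(1) by (simp only:) (rule card_Un_disjoint; auto)
  then show ?thesis using 1 2 col A[of i j] by simp
qed

text \<open>A vertex in a cell attaining \<open>D_max\<close> has all its neighbours outside its own
  class and colour, which limits its degree.\<close>

lemma min_degree_add_D_max_le:
  fixes V :: "nat set"
  assumes G: "balanced_partite r n V E" and chi: "chromatic_number V E \<le> t" and "n > 0" "r > 0"
  obtains A where "row_sums_eq n r t A" "min_degree V E + D_max r t A \<le> (r - 1) * n"
proof -
  have sg: "simple_graph V E" and fin: "finite V"
    using G unfolding balanced_partite_def simple_graph_def by auto
  obtain P :: "nat \<Rightarrow> nat set" where P: "(\<Union>i<r. P i) = V" "disjoint_family_on P {..<r}"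
      "\<And>i. i < r \<Longrightarrow> card (P i) = n" "\<And>i. i < r \<Longrightarrow> independent_set E (P i)"
    using G unfolding balanced_partite_def by auto
  have "\<forall>v\<in>V. \<exists>i. i < r \<and> v \<in> P i" using P(1) by auto
  then obtain p where p: "\<And>v. v \<in> V \<Longrightarrow> p v < r \<and> v \<in> P (p v)" by metis
  have cls: "{v \<in> V. p v = i} = P i" if "i < r" for i
    using p P(1) that disjoint_family_onD[OF P(2), of i] by fastforce
  \<comment> \<open>\<open>chromatic_number\<close> is a \<open>LEAST\<close>, so some proper
    colouring must be exhibited; the identity is one because edges have two distinct ends.\<close>
  have "proper_colouring V E (Suc (Max V)) id"
    unfolding proper_colouring_def
  proof (intro conjI allI impI)
    show "id ` V \<subseteq> {..<Suc (Max V)}" using fin by (auto simp: less_Suc_eq_le)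
    fix u v assume "{u, v} \<in> E"
    then have "card {u, v} = 2" using sg unfolding simple_graph_def by blast
    then show "id u \<noteq> id v" by auto
  qed
  then have "\<exists>f. proper_colouring V E (chromatic_number V E) f"
    unfolding chromatic_number_def
    using LeastI[of "\<lambda>k. \<exists>f. proper_colouring V E k f" "Suc (Max V)"] by blast
  then obtain f where "proper_colouring V E (chromatic_number V E) f" ..
  then have col: "f ` V \<subseteq> {..<chromatic_number V E}" and f: "{u, v} \<in> E \<Longrightarrow> f u \<noteq> f v" for u v
    unfolding proper_colouring_def by simp_all
  have ft: "f ` V \<subseteq> {..<t}"
    using col by (rule subset_trans) (simp add: chi)
  define A where "A i j = card {v \<in> V. p v = i \<and> f v = j}" for i j
  have rows: "row_sums_eq n r t A"
    unfolding row_sums_eq_def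
  proof (intro allI impI)
    fix i assume "i < r"
    then have "n = card {v \<in> V. p v = i}" using cls P(3) by simp
    also have "\<dots> = (\<Sum>j<t. card {u \<in> {v \<in> V. p v = i}. f u = j})"
      using fin ft by (intro card_partition_by) auto
    finally show "(\<Sum>j<t. A i j) = n" unfolding A_def by simp
  qed
  obtain i j where ij: "i < r" "j < t" "A i j > 0" "D_max r t A = col_sum r A j - A i j"
    using D_max_attained[OF rows \<open>n > 0\<close> \<open>r > 0\<close>] .
  have "{v \<in> V. p v = i \<and> f v = j} \<noteq> {}"
    using ij(3) unfolding A_def card_gt_0_iff by (rule conjunct1)
  then obtain v where v: "v \<in> V" "p v = i" "f v = j" by auto
  have "{e \<in> E. v \<in> e} \<subseteq> (\<lambda>u. {v, u}) ` {u \<in> V. p u \<noteq> i \<and> f u \<noteq> j}"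
  proof
    fix e assume e: "e \<in> {e \<in> E. v \<in> e}"
    then have "card e = 2" "e \<subseteq> V" using sg unfolding simple_graph_def by auto
    then obtain u where u: "e = {v, u}" using e by (auto simp: card_2_iff)
    have "u \<in> V" using u \<open>e \<subseteq> V\<close> by auto
    moreover have "f u \<noteq> j" using f[of v u] e u v(3) by simp
    moreover have "p u \<noteq> i"
    proof
      assume "p u = i"
      then have "u \<in> P i" "v \<in> P i" using p[of u] p[of v] \<open>u \<in> V\<close> v by auto
      then show False using P(4)[OF ij(1)] e u unfolding independent_set_def by auto
    qed
    ultimately show "e \<in> (\<lambda>u. {v, u}) ` {u \<in> V. p u \<noteq> i \<and> f u \<noteq> j}" using u by auto
  qed
  then have "degree E v \<le> card {u \<in> V. p u \<noteq> i \<and> f u \<noteq> j}"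
    unfolding degree_def by (rule surj_card_le[rotated]) (simp add: fin)
  moreover have "min_degree V E \<le> degree E v"
    unfolding min_degree_def using fin v by (intro Min_le) auto
  moreover have "card {u \<in> V. p u \<noteq> i \<and> f u \<noteq> j} + (col_sum r A j - A i j) = (r - 1) * n"
    using fin p cls P(3) ij(1) by (intro card_other_class_other_colour) (auto simp: A_def)
  ultimately have "min_degree V E + D_max r t A \<le> (r - 1) * n" using ij(4) by linarith
  then show ?thesis using that rows by blast
qed

text \<open>Realises one matrix row as cell sizes: by induction, colour \<open>t\<close> gets the
  last \<open>a t\<close> points.\<close>

lemma colouring_with_counts:
  fixes a :: "nat \<Rightarrow> nat"
  assumes "(\<Sum>j<t. a j) = n"
  shows "\<exists>g. g ` {..<n} \<subseteq> {..<t} \<and> (\<forall>j<t. card {x. x < n \<and> g x = j} = a j)"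
  using assms
proof (induction t arbitrary: n)
  case 0
  then show ?case by auto
next
  case (Suc t)
  define n' where "n' = (\<Sum>j<t. a j)"
  have n: "n = n' + a t" using Suc.prems unfolding n'_def by simp
  obtain g where g: "g ` {..<n'} \<subseteq> {..<t}" "\<And>j. j < t \<Longrightarrow> card {x. x < n' \<and> g x = j} = a j"
    using Suc.IH[of n'] unfolding n'_def by auto
  define h where "h x = (if x < n' then g x else t)" for x
  have "card {x. x < n \<and> h x = j} = a j" if "j < Suc t" for j
  proof (cases "j = t")
    case True
    have "{x. x < n \<and> h x = j} = {n'..<n}" using g(1) unfolding h_def n True by force
    then show ?thesis using n True by simp
  next
    case False
    have "{x. x < n \<and> h x = j} = {x. x < n' \<and> g x = j}" using False unfolding h_def n by auto
    then show ?thesis using g(2) False that by simp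
  qed
  moreover have "h ` {..<n} \<subseteq> {..<Suc t}" using g(1) unfolding h_def by fastforce
  ultimately show ?case by blast
qed

text \<open>Class \<open>i\<close> is the interval of length \<open>n\<close> starting at
  \<open>i * n\<close>. Joining all pairs that differ in both class and colour makes the degree
  count exact.\<close>

lemma graph_of_matrix:
  assumes A: "row_sums_eq n r t A" and "n > 0" "r > 0"
  obtains V :: "nat set" and E where "balanced_partite r n V E" "chromatic_number V E \<le> t"
    "(r - 1) * n \<le> min_degree V E + D_max r t A"
proof -
  have "\<forall>i. i < r \<longrightarrow> (\<exists>g. g ` {..<n} \<subseteq> {..<t} \<and> (\<forall>j<t. card {x. x < n \<and> g x = j} = A i j))"
    using A colouring_with_counts unfolding row_sums_eq_def by blast
  then obtain g where g: "\<And>i. i < r \<Longrightarrow> g i ` {..<n} \<subseteq> {..<t}"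
      "\<And>i j. i < r \<Longrightarrow> j < t \<Longrightarrow> card {x. x < n \<and> g i x = j} = A i j"
    by metis
  define V where "V = {..<r * n}"
  define p where "p v = v div n" for v
  define f where "f v = g (v div n) (v mod n)" for v
  define E where "E = {{u, v} | u v. u \<in> V \<and> v \<in> V \<and> p u \<noteq> p v \<and> f u \<noteq> f v}"
  have pV: "p ` V \<subseteq> {..<r}" unfolding V_def p_def by (auto simp: less_mult_imp_div_less)
  have fV: "f ` V \<subseteq> {..<t}"
    using g(1) pV \<open>n > 0\<close> unfolding f_def p_def by (auto simp: image_subset_iff)
  have cell: "{v \<in> V. p v = i \<and> Q (v mod n)} = (\<lambda>x. i * n + x) ` {x. x < n \<and> Q x}"
    if "i < r" for i Q
  proof (intro equalityI subsetI)
    fix v assume "v \<in> {v \<in> V. p v = i \<and> Q (v mod n)}"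
    then have "v = i * n + v mod n" "v mod n \<in> {x. x < n \<and> Q x}"
      using \<open>n > 0\<close> unfolding p_def by auto
    then show "v \<in> (\<lambda>x. i * n + x) ` {x. x < n \<and> Q x}" by blast
  next
    fix v assume "v \<in> (\<lambda>x. i * n + x) ` {x. x < n \<and> Q x}"
    moreover have "(i + 1) * n \<le> r * n" using that by (intro mult_right_mono) auto
    ultimately show "v \<in> {v \<in> V. p v = i \<and> Q (v mod n)}" unfolding V_def p_def by auto
  qed
  have card_cell: "card {v \<in> V. p v = i \<and> Q (v mod n)} = card {x. x < n \<and> Q x}" if "i < r" for i Q
    unfolding cell[OF that] by (rule card_image) (auto simp: inj_on_def)
  have cls: "card {v \<in> V. p v = i} = n" if "i < r" for i
    using card_cell[OF that, of "\<lambda>_. True"] by simp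
  \<comment> \<open>\<open>A\<close> is arbitrary outside its \<open>r \<times> t\<close> range,
    while the counting lemma wants cell sizes at all indices.\<close>
  define B where "B i j = card {v \<in> V. p v = i \<and> f v = j}" for i j
  have BA: "B i j = A i j" if "i < r" "j < t" for i j
  proof -
    have "{v \<in> V. p v = i \<and> f v = j} = {v \<in> V. p v = i \<and> g i (v mod n) = j}"
      unfolding f_def p_def by auto
    then show ?thesis using card_cell[OF that(1), of "\<lambda>x. g i x = j"] g(2) that by (simp add: B_def)
  qed
  have fin: "finite V" unfolding V_def by simp
  have Eiff: "{u, v} \<in> E \<longleftrightarrow> u \<in> V \<and> v \<in> V \<and> p u \<noteq> p v \<and> f u \<noteq> f v" for u v
    unfolding E_def by (auto simp: doubleton_eq_iff)
  have "simple_graph V E" unfolding simple_graph_def using fin by (auto simp: E_def card_insert_if)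
  moreover have "(\<Union>i<r. {v \<in> V. p v = i}) = V" using pV by auto
  moreover have "disjoint_family_on (\<lambda>i. {v \<in> V. p v = i}) {..<r}"
    unfolding disjoint_family_on_def by auto
  moreover have "independent_set E {v \<in> V. p v = i}" for i
    unfolding independent_set_def Eiff by auto
  ultimately have G: "balanced_partite r n V E"
    unfolding balanced_partite_def using cls by (intro conjI exI[of _ "\<lambda>i. {v \<in> V. p v = i}"]) auto
  have "proper_colouring V E t f" unfolding proper_colouring_def using fV Eiff by auto
  then have chi: "chromatic_number V E \<le> t" unfolding chromatic_number_def by (intro Least_le) blast
  have "0 \<in> V" unfolding V_def using assms by auto
  then have "min_degree V E \<in> degree E ` V"
    unfolding min_degree_def using fin by (intro Min_in) auto
  then obtain v where v: "v \<in> V" "min_degree V E = degree E v" by auto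
  have "{e \<in> E. v \<in> e} = (\<lambda>u. {v, u}) ` {u \<in> V. p u \<noteq> p v \<and> f u \<noteq> f v}"
    using v(1) unfolding E_def by (auto simp: insert_commute)
  then have "degree E v = card ((\<lambda>u. {v, u}) ` {u \<in> V. p u \<noteq> p v \<and> f u \<noteq> f v})"
    unfolding degree_def by simp
  also have "\<dots> = card {u \<in> V. p u \<noteq> p v \<and> f u \<noteq> f v}"
    by (rule card_image) (auto simp: inj_on_def doubleton_eq_iff)
  finally have deg: "degree E v = card {u \<in> V. p u \<noteq> p v \<and> f u \<noteq> f v}" .
  have pv: "p v < r" "f v < t" using pV fV v by auto
  have "card {u \<in> V. p u \<noteq> p v \<and> f u \<noteq> f v} + (col_sum r B (f v) - B (p v) (f v)) = (r - 1) * n"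
    using fin pV cls pv by (intro card_other_class_other_colour) (auto simp: B_def)
  moreover have "col_sum r B (f v) = col_sum r A (f v)"
    unfolding col_sum_def using BA pv by auto
  moreover have "B (p v) (f v) > 0" unfolding B_def using v(1) fin by (auto simp: card_gt_0_iff)
  ultimately have "(r - 1) * n \<le> min_degree V E + D_max r t A"
    using D_max_le_iff[OF A assms(2,3), of "D_max r t A"] pv BA[OF pv] deg v(2) by fastforce
  then show ?thesis using that G chi by blast
qed

lemma D_max_set_finite:
  assumes "n > 0" "r > 0"
  shows "finite {D_max r t A | A. row_sums_eq n r t A}"
proof (rule finite_subset)
  show "{D_max r t A | A. row_sums_eq n r t A} \<subseteq> {..r * n}"
  proof
    fix k assume "k \<in> {D_max r t A | A. row_sums_eq n r t A}"
    then obtain A where A: "row_sums_eq n r t A" and k: "k = D_max r t A" by blast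
    have "col_sum r A j \<le> r * n" if "j < t" for j
      using sum_mono2[of "{..<t}" "{j}" "col_sum r A"] sum_col_sum[OF A] that by simp
    then show "k \<in> {..r * n}"
      unfolding k using D_max_le_iff[OF A assms] by (auto intro: trans_le_add1)
  qed
qed simp

lemma row_sums_eq_exists:
  assumes "t > 0"
  shows "\<exists>A. row_sums_eq n r t A"
  using assms by (intro exI[of _ "\<lambda>i j. if j = 0 then n else 0"]) (simp add: row_sums_eq_def)

text \<open>One translation bounds every minimum degree, the other attains the bound from an optimal
  matrix. The additive form avoids natural-number subtraction.\<close>

lemma delta_max_add_Min_D_max:
  assumes "n > 0" "r > 0" "t > 0"
  shows "delta_max n r t + Min {D_max r t A | A. row_sums_eq n r t A} = (r - 1) * n"
proof -
  define M where "M = Min {D_max r t A | A. row_sums_eq n r t A}"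
  define S where "S = {min_degree V E | (V :: nat set) E. balanced_partite r n V E \<and> chromatic_number V E \<le> t}"
  have fin: "finite {D_max r t A | A. row_sums_eq n r t A}" by (rule D_max_set_finite[OF assms(1,2)])
  have "M \<in> {D_max r t A | A. row_sums_eq n r t A}"
    unfolding M_def using fin row_sums_eq_exists[OF assms(3)] by (intro Min_in) auto
  then obtain A where A: "row_sums_eq n r t A" "D_max r t A = M" by auto
  have upper: "k + M \<le> (r - 1) * n" if "k \<in> S" for k
  proof -
    obtain V :: "nat set" and E where VE: "balanced_partite r n V E" "chromatic_number V E \<le> t"
        "k = min_degree V E" using \<open>k \<in> S\<close> unfolding S_def by blast
    obtain B where B: "row_sums_eq n r t B" "min_degree V E + D_max r t B \<le> (r - 1) * n"
      using min_degree_add_D_max_le[OF VE(1,2) assms(1,2)] .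
    have "M \<le> D_max r t B" unfolding M_def using fin B(1) by (intro Min_le) auto
    then show ?thesis using B(2) VE(3) by linarith
  qed
  obtain V :: "nat set" and E where VE: "balanced_partite r n V E" "chromatic_number V E \<le> t"
      "(r - 1) * n \<le> min_degree V E + D_max r t A"
    using graph_of_matrix[OF A(1) assms(1,2)] .
  then have "min_degree V E \<in> S" unfolding S_def by blast
  moreover have "k \<le> min_degree V E" if "k \<in> S" for k using upper[OF that] VE(3) A(2) by linarith
  moreover have "finite S" using upper by (intro finite_subset[of S "{..(r - 1) * n}"]) (auto dest: upper)
  ultimately have "Max S = min_degree V E" by (intro Max_eqI) auto
  then show ?thesis using upper[OF \<open>min_degree V E \<in> S\<close>] VE(3) A(2)
    unfolding delta_max_def S_def [symmetric] M_def [symmetric] by linarith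
qed

section \<open>Evaluation of the minimum\<close>

text \<open>The upper bound on \<open>d\<close> keeps all weights at most \<open>n\<close>: it gives
  \<open>s \<le> n\<close>, and \<open>s < n\<close> once the remainder is positive. Here
  \<open>d\<close> is arbitrary, since the theorem uses this for its \<open>d\<close> and for
  \<open>d + 1\<close>.\<close>

lemma matrix_exists_slack_int:
  fixes d :: int
  assumes "n > 0" "m \<ge> 2" "t \<ge> 2" "a \<le> m" "r + a = m * t" "d \<ge> 0" "d \<le> (int m - 1) * int n"
    and slack: "int r * int n < int n + int t * d + (int t - 2) * (d div (int m - 1))"
  shows "\<exists>A. row_sums_eq n r t A \<and> int (D_max r t A) \<le> d"
proof -
  define s T where "s = d div (int m - 1)" and "T = d mod (int m - 1)"
  have d: "d = (int m - 1) * s + T" unfolding s_def T_def by simp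
  have T: "0 \<le> T" "T < int m - 1" using assms(2) unfolding T_def by auto
  have s0: "s \<ge> 0" using assms unfolding s_def by (simp add: pos_imp_zdiv_nonneg_iff)
  have "(int m - 1) * s \<le> (int m - 1) * int n" using d T assms(7) by linarith
  then have sn: "s \<le> int n" using assms(2) by simp
  have sT: "s < int n" if "T > 0"
  proof -
    have "(int m - 1) * s < (int m - 1) * int n" using d that assms(7) by linarith
    then show ?thesis using assms(2) by (simp add: mult_less_cancel_left)
  qed
  have "\<exists>A. row_sums_eq n r t A \<and> D_max r t A \<le> nat d"
  proof (rule matrix_exists_slack[of n m t a r "nat d" "nat s" "nat T"])
    have "int (nat d) = int ((m - 1) * nat s + nat T)"
      using d T s0 assms(2,6) by (simp add: of_nat_diff)
    then show "nat d = (m - 1) * nat s + nat T" by (simp only: of_nat_eq_iff)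
    have "int (r * n) < int (n + t * nat d + (t - 2) * nat s)"
      using slack s0 assms(3,6) unfolding s_def [symmetric] by (simp add: of_nat_diff)
    then show "r * n < n + t * nat d + (t - 2) * nat s" by (simp only: of_nat_less_iff)
  qed (use assms T sn sT in auto)
  then show ?thesis using assms(6) by auto
qed

theorem theorem3p1:
  fixes n m t a r :: nat and d s T H eps :: int
  assumes "n > 0" and "m \<ge> 2" and "t \<ge> 3"
    and "2 \<le> a" and "a \<le> min m (t - 1)"
    and "r = m * t - a"
    and "d = \<lceil>(real m - 1) * (real r - 1) * real n / (real m * real t - 2)\<rceil>"
    and "s = \<lfloor>real_of_int d / (real m - 1)\<rfloor>"
    and "T = d - (int m - 1) * s"
    and "H = int n + int t * d + (int t - 2) * s - int r * int n"
    and "eps = (if H < 0 then 1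
                else if H = 0 \<and> \<not> (int n - s) dvd T then 1
                else 0)"
  shows "T \<in> {0..int m - 2}
    \<and> int (delta_max n r t) = (int r - 1) * int n - d - eps
    \<and> int (Min {D_max r t A | A. row_sums_eq n r t A}) = d + eps"
proof -
  define \<mu> where "\<mu> = int m * int t - 2"
  have mt: "m * t \<ge> 2 * t" using assms(2) by (intro mult_right_mono) auto
  have am: "a \<le> m" "a \<le> t - 1" using assms(5) by auto
  have r: "r + a = m * t" using mt am assms(3,6) by linarith
  have rZ: "int r = int m * int t - int a" using r by (metis add_diff_cancel_right' of_nat_add of_nat_mult)
  have r0: "r > t" using r mt am assms(3) by linarith
  have mtZ: "int m * int t \<ge> 2 * int t" using mt by (metis of_nat_mult of_nat_numeral of_nat_mono)
  have pos: "\<mu> > 0" unfolding \<mu>_def using mtZ assms(3) by linarith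
  define q where "q = (int m - 1) * (int r - 1) * int n"
  have dq: "d = \<lceil>real_of_int q / real_of_int \<mu>\<rceil>" unfolding assms(7) q_def \<mu>_def by simp
  have posR: "real_of_int \<mu> > 0" using pos by simp
  have "real_of_int q / real_of_int \<mu> \<le> real_of_int d" unfolding dq by (rule le_of_int_ceiling)
  then have "real_of_int q \<le> real_of_int (\<mu> * d)" using posR by (simp add: pos_divide_le_eq mult_ac)
  then have dle: "q \<le> \<mu> * d" by (simp only: of_int_le_iff)
  have "real_of_int (d - 1) < real_of_int q / real_of_int \<mu>"
    unfolding dq using ceiling_correct[of "real_of_int q / real_of_int \<mu>"] by simp
  then have "real_of_int (\<mu> * (d - 1)) < real_of_int q" using posR by (simp add: pos_less_divide_eq mult_ac)
  then have dgt: "\<mu> * (d - 1) < q" by (simp only: of_int_less_iff)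
  have "real m - 1 = real_of_int (int m - 1)" by simp
  then have s: "s = d div (int m - 1)"
    unfolding assms(8) by (simp only: floor_divide_of_int_eq)
  have T: "T = d mod (int m - 1)" unfolding assms(9) s by (simp add: minus_mult_div_eq_mod)
  have Trange: "0 \<le> T" "T \<le> int m - 2"
    using assms(2) pos_mod_bound[of "int m - 1" d] pos_mod_sign[of "int m - 1" d] unfolding T
    by linarith+
  have d: "d = (int m - 1) * s + T" unfolding assms(9) by simp
  have thr: "int ((m - 1)\<^sup>2 * n) \<le> int m * d"
    using threshold_large[of m t a r n d] assms(2,3) am r dle unfolding q_def \<mu>_def by simp
  have "int m * d \<ge> 0" using thr by (meson of_nat_0_le_iff order_trans)
  then have d0: "d \<ge> 0" using assms(2) by (simp add: zero_le_mult_iff)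
  then have s0: "s \<ge> 0" using assms(2) unfolding s by (simp add: pos_imp_zdiv_nonneg_iff)
  \<comment> \<open>As \<open>r - 1 \<le> m * t - 2\<close>, the unrounded threshold is at most this
    integer, hence so is its ceiling.\<close>
  have dn: "d \<le> (int m - 1) * int n"
  proof -
    have "((int m - 1) * int n) * (int r - 1) \<le> ((int m - 1) * int n) * \<mu>"
      using assms(2,4) rZ unfolding \<mu>_def by (intro mult_left_mono) auto
    then have "\<mu> * (d - 1) < \<mu> * ((int m - 1) * int n)" using dgt unfolding q_def by (simp add: mult_ac)
    then show ?thesis using pos by (simp add: mult_less_cancel_left)
  qed
  \<comment> \<open>At the extreme \<open>d = (m - 1) * n\<close> one has \<open>s = n\<close> and
    \<open>H = n * (a - 1) > 0\<close>.\<close>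
  have dlt: "d < (int m - 1) * int n" if "H \<le> 0"
  proof (rule ccontr)
    assume "\<not> ?thesis"
    then have eq: "d = (int m - 1) * int n" using dn by simp
    then have "s = int n" using assms(2) unfolding s by simp
    then have "H = int n * (int a - 1)" unfolding assms(10) eq rZ by (simp add: algebra_simps)
    then show False using that assms(1,4) by (simp add: mult_le_0_iff)
  qed
  have slt: "s < int n" if "H \<le> 0"
  proof -
    have "(int m - 1) * s < (int m - 1) * int n" using dlt[OF that] d Trange by linarith
    then show ?thesis using assms(2) by (simp add: mult_less_cancel_left)
  qed
  have lower: "d + eps \<le> int (D_max r t A)" if A: "row_sums_eq n r t A" for A
  proof -
    have "q \<le> \<mu> * int (D_max r t A)"
      using D_max_threshold[OF A] assms(1-4) am r unfolding q_def \<mu>_def by simp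
    then have "\<mu> * (d - 1) < \<mu> * int (D_max r t A)" using dgt by linarith
    then have ge: "d \<le> int (D_max r t A)" using pos by (simp add: mult_less_cancel_left)
    show ?thesis
    proof (rule ccontr)
      assume "\<not> ?thesis"
      then have K: "int (D_max r t A) \<le> d" and e: "eps = 1"
        using ge unfolding assms(11) by (auto split: if_splits)
      have Hle: "H \<le> 0" using e unfolding assms(11) by (auto split: if_splits)
      have m1: "int (m - 1) = int m - 1" using assms(2) by simp
      have "(m - 1) * t = m * t - t" by (simp add: diff_mult_distrib)
      then have rbig: "(m - 1) * t < r" using r mt am assms(3) by linarith
      have dlt': "d < int ((m - 1) * n)" using dlt[OF Hle] m1 by simp
      have s': "s = d div int (m - 1)" unfolding s m1 ..
      note split = split_row_bound[OF A assms(1-3) rbig K dlt' thr s', folded assms(10)]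
      have H0: "H = 0" using split(1) Hle by simp
      then have ndvd: "\<not> (int n - s) dvd T" using e unfolding assms(11) by (auto split: if_splits)
      obtain j where j: "int (col_sum r A j) = d + s"
          "\<And>i. i < r \<Longrightarrow> A i j > 0 \<Longrightarrow> A i j = n \<or> int (A i j) = s"
        using split(2)[OF H0] by blast
      obtain e f :: nat where ef: "int (\<Sum>i<r. A i j) = int e * int n + int f * s"
        using sum_two_valued[of r "\<lambda>i. A i j" n s] j(2) by blast
      \<comment> \<open>A rearrangement of \<open>thr\<close>; dividing and rounding down yields
        \<open>low\<close>, which rules out columns with too few entries.\<close>
      have "(int m - 1) * ((int m - 1) * int n - d) \<le> d"
        using thr unfolding of_nat_mult of_nat_power m1
        by (simp add: power2_eq_square algebra_simps)
      then have "((int m - 1) * ((int m - 1) * int n - d)) div (int m - 1) \<le> s"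
        unfolding s using assms(2) by (intro zdiv_mono1) auto
      then have low: "(int m - 1) * int n - d \<le> s" using assms(2) by simp
      have "(int n - s) dvd T"
      proof (rule tight_column_dvd[of "int m" "int t" "int a" T s "int n" "int e" "int f"])
        show "int e * int n + int f * s = int m * s + T"
          using ef j(1) d unfolding col_sum_def by (simp add: algebra_simps)
        show "(int m - 1) * int n \<le> int m * s + T"
          using low d by (simp add: algebra_simps)
        show "int n + int t * ((int m - 1) * s + T) + (int t - 2) * s = (int m * int t - int a) * int n"
          using H0 unfolding assms(10) d [symmetric] rZ by simp
      qed (use assms(2-4) am Trange s0 slt[OF Hle] in auto)
      then show False using ndvd by simp
    qed
  qed
  have upper: "\<exists>A. row_sums_eq n r t A \<and> int (D_max r t A) \<le> d + eps"
  proof (cases "H > 0")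
    case True
    then show ?thesis
      using matrix_exists_slack_int[of n m t a r d] assms(1-3) am r d0 dn
      unfolding assms(10,11) s by simp
  next
    case False
    show ?thesis
    proof (cases "H = 0 \<and> (int n - s) dvd T")
      case True
      have "\<exists>A. row_sums_eq n r t A \<and> D_max r t A \<le> nat d"
      proof (rule matrix_exists_tight[of n m t a r "nat d" "nat s" "nat T"])
        have "int (nat d) = int ((m - 1) * nat s + nat T)"
          using d Trange s0 d0 assms(2) by (simp add: of_nat_diff)
        then show "nat d = (m - 1) * nat s + nat T" by (simp only: of_nat_eq_iff)
        have "int (r * n) = int (n + t * nat d + (t - 2) * nat s)"
          using True s0 d0 assms(3) unfolding assms(10) by (simp add: of_nat_diff)
        then show "r * n = n + t * nat d + (t - 2) * nat s" by (simp only: of_nat_eq_iff)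
        have "int (n - nat s) dvd int (nat T)"
          using True s0 slt Trange by (simp add: of_nat_diff nat_le_iff)
        then show "n - nat s dvd nat T" by (simp only: int_dvd_int_iff)
      qed (use assms(1-3) am r Trange slt s0 True in auto)
      then show ?thesis using d0 True unfolding assms(11) by auto
    next
      case F: False
      then have e: "eps = 1" using False unfolding assms(11) by auto
      \<comment> \<open>Since \<open>q \<le> \<mu> * d\<close> and \<open>T < m - 1\<close>,
        \<open>H\<close> exceeds \<open>-(t - 2)\<close>. Replacing \<open>d\<close> by
        \<open>d + 1\<close> adds \<open>t\<close> and does not lower the quotient, so the slack
        becomes positive; \<open>dlt\<close> leaves room for \<open>d + 1\<close>.\<close>
      have "(int m - 1) * (H + (int t - 2)) = \<mu> * d - q + (int t - 2) * (int m - 1 - T)"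
        unfolding assms(9,10) \<mu>_def q_def by (simp add: algebra_simps)
      moreover have "(int t - 2) * (int m - 1 - T) > 0"
        using assms(3) Trange by (intro mult_pos_pos) auto
      ultimately have "(int m - 1) * (H + (int t - 2)) > 0" using dle by linarith
      then have H: "H + (int t - 2) > 0" using assms(2) by (simp add: zero_less_mult_iff)
      have "s \<le> (d + 1) div (int m - 1)" unfolding s using assms(2) by (intro zdiv_mono1) auto
      then have "(int t - 2) * s \<le> (int t - 2) * ((d + 1) div (int m - 1))"
        using assms(3) by (intro mult_left_mono) auto
      then have "int r * int n < int n + int t * (d + 1) + (int t - 2) * ((d + 1) div (int m - 1))"
        using H unfolding assms(10) by (simp add: algebra_simps)
      then show ?thesis
        using matrix_exists_slack_int[of n m t a r "d + 1"] assms(1-3) am r d0 dlt False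
        unfolding e by simp
    qed
  qed
  have "int (Min {D_max r t A | A. row_sums_eq n r t A}) = d + eps"
  proof -
    obtain A where A: "row_sums_eq n r t A" "int (D_max r t A) = d + eps"
      using upper lower by (metis order_antisym)
    have "Min {D_max r t A | A. row_sums_eq n r t A} = D_max r t A"
    proof (rule Min_eqI)
      show "finite {D_max r t A | A. row_sums_eq n r t A}"
        using D_max_set_finite assms(1) r0 by auto
      show "D_max r t A \<le> k" if "k \<in> {D_max r t A | A. row_sums_eq n r t A}" for k
        using that lower A(2) by fastforce
    qed (use A(1) in blast)
    then show ?thesis using A(2) by simp
  qed
  moreover have "int (delta_max n r t) = (int r - 1) * int n - int (Min {D_max r t A | A. row_sums_eq n r t A})"
  proof -
    have "int (delta_max n r t + Min {D_max r t A | A. row_sums_eq n r t A}) = int ((r - 1) * n)"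
      using delta_max_add_Min_D_max[of n r t] assms(1,3) r0 by simp
    then show ?thesis using r0 by (simp add: of_nat_diff)
  qed
  ultimately show ?thesis using Trange by simp
qed

end
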